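(* Let $a<b$ be real numbers. Assume that $g:[a,b]\to\mathbb{R}$ has a (finite) derivative almost everywhere on $[a,b]$ and that $f:\mathbb{R}\to\mathbb{R}$ is HK integrable on every closed interval with endpoints in the range of $g$. Define $F(x):=(HK)\int_{g(a)}^{x}f(u)\,du$ (for $x$ in the smallest interval containing the range of $g$). Let $B\subseteq[a,b]$ be the set of points where the equality $(F\circ g)'=(f\circ g)\cdot g'$ fails. Then the following are equivalent: (i) $(f\circ g)\cdot g'$ is HK integrable on $[a,b]$ and $$(HK)\int_{g(a)}^{g(b)}f(u)\,du=(HK)\int_{a}^{b}f(g(s))\,g'(s)\,ds;$$ (ii) $F\circ g$ has negligible conditional variation on $B$.
   Context: Derivatives are finite derivatives; at the endpoints of $[a,b]$ they are one-sided. The equality $(F\circ g)'(x)=f(g(x))g'(x)$ is said to fail at $x\in[a,b]$ if it is false at $x$ or if either side is undefined at $x$ (in particular if $F\circ g$ is not differentiable at $x$ or $g'(x)$ does not exist). A tagged partition of $[a,b]$ is a finite set $P=\{(x_j,I_j):1\le j\le n\}$ with closed intervals $I_j=[a_j,b_j]$, $x_j\in I_j$, $\bigcup_j I_j=[a,b]$, and $(a_i,b_i)\cap(a_j,b_j)=\emptyset$ for $i\ne j$. A gauge on $[a,b]$ is a function $\delta:[a,b]\to(0,\infty)$. $P$ is subordinate to $\delta$ if $I_j\subseteq(x_j-\delta(x_j),x_j+\delta(x_j))$ for every $j$. A function $\phi:[a,b]\to\mathbb{R}$ is HK (Henstock–Kurzweil) integrable over $[a,b]$ with integral $(HK)\int_a^b\phi(x)\,dx=A$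 if for every $\epsilon>0$ there is a gauge $\delta$ on $[a,b]$ such that every tagged partition $P$ of $[a,b]$ subordinate to $\delta$ satisfies $\left|\sum_{j}\phi(x_j)(b_j-a_j)-A\right|<\epsilon$. One sets $(HK)\int_b^a\phi=-(HK)\int_a^b\phi$; the integral over a degenerate interval is $0$. If $\phi$ is only defined almost everywhere, its HK integral means that of the function equal to $\phi$ where $\phi$ is defined and $0$ elsewhere. A function $\phi:[a,b]\to\mathbb{R}$ has negligible conditional variation on a set $E\subseteq[a,b]$ if for every $\epsilon>0$ there is a gauge $\delta$ on $[a,b]$ such that for every tagged partition $\{(x_j,[a_j,b_j]):1\le j\le n\}$ of $[a,b]$ subordinate to $\delta$, $\left|\sum_{x_j\in E}(\phi(b_j)-\phi(a_j))\right|<\epsilon$. *)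

theory Defs
  imports "HOL-Analysis.Analysis"
begin

text \<open>The Henstock--Kurzweil integral is the library's gauge integral
  (\<^const>\<open>has_integral\<close>, \<^const>\<open>integrable_on\<close>, \<^const>\<open>integral\<close>).
  The library has no oriented version of it.\<close>

definition hk_integral :: "real \<Rightarrow> real \<Rightarrow> (real \<Rightarrow> real) \<Rightarrow> real" where
  "hk_integral c d \<phi> = (if c \<le> d then integral {c..d} \<phi> else - integral {d..c} \<phi>)"

text \<open>For a member \<open>(x, k)\<close> of a tagged division, \<open>k\<close> is a nonempty (possibly degenerate) compact
  interval, so \<open>Inf k\<close> and \<open>Sup k\<close> are its left and right endpoints; being fine for the balls
  below means \<open>k \<subseteq> {x - \<delta> x<..<x + \<delta> x}\<close>.\<close>

definition negligible_conditional_variation ::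
    "real \<Rightarrow> real \<Rightarrow> (real \<Rightarrow> real) \<Rightarrow> real set \<Rightarrow> bool" where
  "negligible_conditional_variation a b \<phi> E \<longleftrightarrow>
     (\<forall>\<epsilon>>0. \<exists>\<delta> :: real \<Rightarrow> real. (\<forall>x\<in>{a..b}. \<delta> x > 0) \<and>
        (\<forall>P. P tagged_division_of {a..b} \<and> (\<lambda>x. ball x (\<delta> x)) fine P \<longrightarrow>
           \<bar>\<Sum>(x, k) \<in> {(x, k) \<in> P. x \<in> E}. \<phi> (Sup k) - \<phi> (Inf k)\<bar> < \<epsilon>))"

text \<open>Derivatives are taken within \<open>{a..b}\<close>, hence one-sided at the endpoints. The equation
  \<open>(F \<circ> g)' = (f \<circ> g) * g'\<close> also counts as failing where either side is undefined.\<close>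

definition chain_rule_failure_set ::
    "real \<Rightarrow> real \<Rightarrow> (real \<Rightarrow> real) \<Rightarrow> (real \<Rightarrow> real) \<Rightarrow> (real \<Rightarrow> real) \<Rightarrow> real set" where
  "chain_rule_failure_set a b F f g =
     {x \<in> {a..b}. \<not> (\<exists>D. (g has_real_derivative D) (at x within {a..b}) \<and>
        ((F \<circ> g) has_real_derivative (f (g x) * D)) (at x within {a..b}))}"

text \<open>\<open>(f \<circ> g) * g'\<close>, extended by \<open>0\<close> to the points where \<open>g'\<close> does not exist.\<close>

definition chain_integrand ::
    "real \<Rightarrow> real \<Rightarrow> (real \<Rightarrow> real) \<Rightarrow> (real \<Rightarrow> real) \<Rightarrow> real \<Rightarrow> real" where
  "chain_integrand a b f g s =
     (if g differentiable (at s within {a..b})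
      then f (g s) * vector_derivative g (at s within {a..b}) else 0)"

end

theory Submission
  imports Defs
begin

text \<open>
  Put \<open>G = F \<circ> g\<close> and let \<open>h\<close> be the integrand \<open>(f \<circ> g) * g'\<close>. Since \<open>F (g a) = 0\<close>, statement (i)
  says that \<open>h\<close> has integral \<open>G b - G a\<close>. For a tagged division \<open>P\<close>, the increments of \<open>G\<close> over all
  of \<open>P\<close> telescope to \<open>G b - G a\<close>. Split that sum according to whether the tag lies in \<open>B\<close>. For a tag
  \<open>x\<close> outside \<open>B\<close> the derivative of \<open>G\<close> at \<open>x\<close> is \<open>h x\<close>, so on a fine division the increments there
  differ from the Riemann sum of \<open>h\<close> by an arbitrarily small amount (the straddle estimate). Hence,
  up to a small error, the sum of the increments of \<open>G\<close> tagged in \<open>B\<close> is \<open>G b - G a\<close> minus the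
  Riemann sum of \<open>h\<close> restricted to the complement of \<open>B\<close>. If \<open>h = 0\<close> almost everywhere on \<open>B\<close>, that
  restriction has the same integral as \<open>h\<close>, and the equivalence follows: this is
  \<open>has_integral_increment_iff_negligible_conditional_variation\<close>.

  It remains to see that \<open>h = 0\<close> almost everywhere on \<open>B\<close>. Let \<open>E\<close> be the set of points of \<open>B\<close> where
  \<open>h \<noteq> 0\<close>. If \<open>x \<in> E\<close>, then \<open>g' x\<close> exists (otherwise \<open>h x\<close> is \<open>0\<close> by convention) and is nonzero,
  while the chain rule fails at \<open>x\<close>; so \<open>F\<close> cannot have derivative \<open>f (g x)\<close> at \<open>g x\<close>. An indefinite Henstock--Kurzweil integral has its
  integrand as derivative almost everywhere (\<open>negligible_hk_integral_not_deriv\<close>), and therefore \<open>g\<close>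
  maps \<open>E\<close> into a null set. A function with nonzero derivative at every point of a set cannot map it
  onto a null set unless the set is itself null (\<open>negligible_if_negligible_image_nonzero_deriv\<close>). So
  \<open>E\<close> is null.
\<close>

section \<open>Gauges and conditional variation\<close>

text \<open>The radii of the definition are only positive on \<open>{a..b}\<close>, so the balls need not form a gauge;
  since all tags lie in \<open>{a..b}\<close>, enlarging the radii elsewhere changes nothing.\<close>

lemma negligible_conditional_variation_iff_gauge:
  "negligible_conditional_variation a b \<phi> E \<longleftrightarrow>
     (\<forall>\<epsilon>>0. \<exists>\<gamma>. gauge \<gamma> \<and> (\<forall>P. P tagged_division_of {a..b} \<and> \<gamma> fine P \<longrightarrow>
        \<bar>\<Sum>(x, k) \<in> {(x, k) \<in> P. x \<in> E}. \<phi> (Sup k) - \<phi> (Inf k)\<bar> < \<epsilon>))"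
proof -
  define V where "V P = \<bar>\<Sum>(x, k) \<in> {(x, k) \<in> P. x \<in> E}. \<phi> (Sup k) - \<phi> (Inf k)\<bar>"
    for P :: "(real \<times> real set) set"
  have "(\<exists>\<delta>. (\<forall>x\<in>{a..b}. \<delta> x > 0) \<and>
          (\<forall>P. P tagged_division_of {a..b} \<and> (\<lambda>x. ball x (\<delta> x)) fine P \<longrightarrow> V P < \<epsilon>)) \<longleftrightarrow>
        (\<exists>\<gamma>. gauge \<gamma> \<and> (\<forall>P. P tagged_division_of {a..b} \<and> \<gamma> fine P \<longrightarrow> V P < \<epsilon>))"
    (is "?lhs \<longleftrightarrow> ?rhs") for \<epsilon>
  proof
    assume ?lhs
    then obtain \<delta> where \<delta>: "\<forall>x\<in>{a..b}. \<delta> x > 0"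
      and small: "\<And>P. P tagged_division_of {a..b} \<Longrightarrow> (\<lambda>x. ball x (\<delta> x)) fine P \<Longrightarrow> V P < \<epsilon>"
      by blast
    define \<gamma> where "\<gamma> x = ball x (if x \<in> {a..b} then \<delta> x else 1)" for x
    have "gauge \<gamma>"
      unfolding gauge_def \<gamma>_def using \<delta> by auto
    moreover have "(\<lambda>x. ball x (\<delta> x)) fine P"
      if P: "P tagged_division_of {a..b}" and "\<gamma> fine P" for P
    proof (rule fineI)
      fix x K assume xK: "(x, K) \<in> P"
      then have "x \<in> {a..b}"
        using tagged_division_ofD(2,3)[OF P xK] by blast
      with fineD[OF \<open>\<gamma> fine P\<close> xK] show "K \<subseteq> ball x (\<delta> x)"
        by (simp add: \<gamma>_def)
    qed
    ultimately show ?rhs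
      using small by (intro exI[of _ \<gamma>]) simp
  next
    assume ?rhs
    then obtain \<gamma> where "gauge \<gamma>"
      and small: "\<forall>P. P tagged_division_of {a..b} \<and> \<gamma> fine P \<longrightarrow> V P < \<epsilon>"
      by (elim exE conjE)
    have "\<forall>x. \<exists>d>0. ball x d \<subseteq> \<gamma> x"
      using \<open>gauge \<gamma>\<close> unfolding gauge_def by (meson openE)
    then obtain \<delta> where \<delta>: "\<And>x. \<delta> x > 0" "\<And>x. ball x (\<delta> x) \<subseteq> \<gamma> x"
      by metis
    have "\<gamma> fine P" if "(\<lambda>x. ball x (\<delta> x)) fine P" for P
      using that \<delta>(2) unfolding fine_def by blast
    then show ?lhs
      using small \<delta>(1) by (intro exI[of _ \<delta>]) simp
  qed
  then show ?thesis
    unfolding negligible_conditional_variation_def V_def by simp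
qed

section \<open>The integral of a derivative and conditional variation\<close>

text \<open>Subtract the first-order expansions of \<open>G\<close> at \<open>x\<close> for the points \<open>u \<le> x\<close> and \<open>v \<ge> x\<close>; as \<open>x\<close> lies
  between them, the two error terms add up to a multiple of \<open>v - u\<close>.\<close>

lemma straddle_estimate:
  fixes G :: "real \<Rightarrow> real"
  assumes "(G has_real_derivative D) (at x within S)" "e > 0"
  obtains d where "d > 0"
    "\<And>u v. \<lbrakk>u \<in> S; v \<in> S; u \<le> x; x \<le> v; \<bar>u - x\<bar> < d; \<bar>v - x\<bar> < d\<rbrakk>
       \<Longrightarrow> \<bar>G v - G u - D * (v - u)\<bar> \<le> e * (v - u)"
proof -
  obtain d where "d > 0" and
    d: "\<And>y. y \<in> S \<Longrightarrow> \<bar>y - x\<bar> < d \<Longrightarrow> \<bar>G y - G x - D * (y - x)\<bar> \<le> e * \<bar>y - x\<bar>"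
    using assms unfolding has_field_derivative_def has_derivative_within_alt by force
  have "\<bar>G v - G u - D * (v - u)\<bar> \<le> e * (v - u)"
    if "u \<in> S" "v \<in> S" "u \<le> x" "x \<le> v" "\<bar>u - x\<bar> < d" "\<bar>v - x\<bar> < d" for u v
    using d[of u] d[of v] that by (simp add: abs_if algebra_simps split: if_splits)
  with \<open>d > 0\<close> show ?thesis
    using that by blast
qed

text \<open>The straddle estimate bounds each term by \<open>e\<close> times the length of its interval, and the lengths
  add up to \<open>b - a\<close>.\<close>

lemma sum_increments_minus_derivative_small:
  fixes G h :: "real \<Rightarrow> real"
  assumes "a \<le> b"
    and deriv: "\<And>x. x \<in> {a..b} - E \<Longrightarrow> (G has_real_derivative h x) (at x within {a..b})"
    and "\<epsilon> > 0"
  obtains \<gamma> where "gauge \<gamma>"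
    "\<And>P. P tagged_division_of {a..b} \<Longrightarrow> \<gamma> fine P \<Longrightarrow>
       \<bar>(\<Sum>(x, k) \<in> {(x, k) \<in> P. x \<notin> E}. (G (Sup k) - G (Inf k)) - measure lborel k *\<^sub>R h x)\<bar> < \<epsilon>"
proof -
  \<comment> \<open>The summand 1 makes the final bound strict and allows \<open>a = b\<close>.\<close>
  define e where "e = \<epsilon> / (b - a + 1)"
  have e: "e > 0" "e * (b - a) < \<epsilon>"
    using \<open>\<epsilon> > 0\<close> \<open>a \<le> b\<close> by (auto simp: e_def field_simps)
  have "\<exists>d>0. x \<in> {a..b} - E \<longrightarrow> (\<forall>u v. u \<in> {a..b} \<and> v \<in> {a..b} \<and> u \<le> x \<and> x \<le> v \<and>
      \<bar>u - x\<bar> < d \<and> \<bar>v - x\<bar> < d \<longrightarrow> \<bar>G v - G u - h x * (v - u)\<bar> \<le> e * (v - u))" for x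
  proof (cases "x \<in> {a..b} - E")
    case True
    from straddle_estimate[OF deriv[OF True] e(1)] show ?thesis
      by (metis (no_types, lifting))
  qed (auto intro: exI[of _ 1])
  then obtain \<delta> where \<delta>: "\<And>x. \<delta> x > 0" and str: "\<And>x u v. \<lbrakk>x \<in> {a..b} - E; u \<in> {a..b}; v \<in> {a..b};
      u \<le> x; x \<le> v; \<bar>u - x\<bar> < \<delta> x; \<bar>v - x\<bar> < \<delta> x\<rbrakk> \<Longrightarrow> \<bar>G v - G u - h x * (v - u)\<bar> \<le> e * (v - u)"
    by metis
  have "\<bar>(\<Sum>(x, k) \<in> {(x, k) \<in> P. x \<notin> E}. (G (Sup k) - G (Inf k)) - measure lborel k *\<^sub>R h x)\<bar> < \<epsilon>"
    if P: "P tagged_division_of {a..b}" and fine: "(\<lambda>x. ball x (\<delta> x)) fine P" for P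
  proof -
    have fin: "finite P"
      using P by blast
    have "\<bar>(\<Sum>(x, k) \<in> {(x, k) \<in> P. x \<notin> E}. (G (Sup k) - G (Inf k)) - measure lborel k *\<^sub>R h x)\<bar>
        \<le> (\<Sum>(x, k) \<in> {(x, k) \<in> P. x \<notin> E}. e * measure lborel k)"
    proof (rule order_trans[OF sum_abs sum_mono], clarify)
      fix x k assume xk: "(x, k) \<in> P" "x \<notin> E"
      obtain u v where k: "k = {u..v}"
        using tagged_division_ofD(4)[OF P xk(1)] by auto
      have x: "x \<in> k" "k \<subseteq> {a..b}" "k \<subseteq> ball x (\<delta> x)"
        using tagged_division_ofD(2,3)[OF P xk(1)] fineD[OF fine xk(1)] by auto
      have uv: "u \<le> x" "x \<le> v" "u \<in> k" "v \<in> k"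
        using x(1) k by auto
      have "\<bar>u - x\<bar> < \<delta> x" "\<bar>v - x\<bar> < \<delta> x"
        using x(3) uv(3,4) by (force simp: dist_real_def)+
      then have "\<bar>G v - G u - h x * (v - u)\<bar> \<le> e * (v - u)"
        using str[of x u v] x(1,2) uv xk(2) by blast
      then show "\<bar>G (Sup k) - G (Inf k) - measure lborel k *\<^sub>R h x\<bar> \<le> e * measure lborel k"
        using uv(1,2) by (simp add: k mult.commute)
    qed
    also have "\<dots> \<le> (\<Sum>(x, k) \<in> P. e * measure lborel k)"
      using fin e(1) by (intro sum_mono2) auto
    also have "\<dots> = e * (b - a)"
      using additive_content_tagged_division[of P a b] P \<open>a \<le> b\<close>
      by (simp add: case_prod_unfold flip: sum_distrib_left)
    finally show ?thesis
      using e(2) by linarith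
  qed
  moreover have "gauge (\<lambda>x. ball x (\<delta> x))"
    using \<delta> by (simp add: gauge_ball_dependent)
  ultimately show ?thesis
    using that by blast
qed

text \<open>With \<open>S\<close> the sum of the increments of \<open>G\<close> tagged in \<open>E\<close>, and \<open>R\<close> the error of the Riemann sum of
  \<open>h0\<close> (which is \<open>h\<close> cut off to \<open>0\<close> on \<open>E\<close>) as an approximation of \<open>G b - G a\<close>, telescoping shows that
  \<open>S + R\<close> is minus the sum bounded in the preceding lemma. So \<open>S\<close> becomes small with the gauge iff
  \<open>R\<close> does. The first is the conditional variation condition; the second is the integral of \<open>h0\<close>,
  which agrees with \<open>h\<close> almost everywhere.\<close>

lemma has_integral_increment_iff_negligible_conditional_variation:
  fixes G h :: "real \<Rightarrow> real"
  assumes "a \<le> b"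
    and deriv: "\<And>x. x \<in> {a..b} - E \<Longrightarrow> (G has_real_derivative h x) (at x within {a..b})"
    and null: "negligible {x \<in> E. h x \<noteq> 0}"
  shows "(h has_integral (G b - G a)) {a..b} \<longleftrightarrow> negligible_conditional_variation a b G E"
proof -
  define h0 where "h0 x = (if x \<in> E then 0 else h x)" for x
  define S where "S P = (\<Sum>(x, k) \<in> {(x, k) \<in> P. x \<in> E}. G (Sup k) - G (Inf k))"
    for P :: "(real \<times> real set) set"
  define R where "R P = (\<Sum>(x, k) \<in> P. measure lborel k *\<^sub>R h0 x) - (G b - G a)"
    for P :: "(real \<times> real set) set"
  have near: "\<exists>\<gamma>. gauge \<gamma> \<and> (\<forall>P. P tagged_division_of {a..b} \<longrightarrow> \<gamma> fine P \<longrightarrow> \<bar>S P + R P\<bar> < \<epsilon>)"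
    if "\<epsilon> > 0" for \<epsilon>
  proof -
    obtain \<gamma> where "gauge \<gamma>" and small: "\<And>P. P tagged_division_of {a..b} \<Longrightarrow> \<gamma> fine P \<Longrightarrow>
       \<bar>(\<Sum>(x, k) \<in> {(x, k) \<in> P. x \<notin> E}. (G (Sup k) - G (Inf k)) - measure lborel k *\<^sub>R h x)\<bar> < \<epsilon>"
      using sum_increments_minus_derivative_small[OF \<open>a \<le> b\<close> deriv \<open>\<epsilon> > 0\<close>] by blast
    have "\<bar>S P + R P\<bar> < \<epsilon>" if P: "P tagged_division_of {a..b}" and "\<gamma> fine P" for P
    proof -
      have fin: "finite P"
        using P by blast
      have "(\<Sum>(x, k) \<in> P. G (Sup k) - G (Inf k)) - (\<Sum>(x, k) \<in> P. measure lborel k *\<^sub>R h0 x)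
          = (\<Sum>(x, k) \<in> P. if x \<in> E then G (Sup k) - G (Inf k) else 0)
            + (\<Sum>(x, k) \<in> P. if x \<notin> E then (G (Sup k) - G (Inf k)) - measure lborel k *\<^sub>R h x else 0)"
        by (auto simp: case_prod_unfold h0_def simp flip: sum.distrib sum_subtractf intro!: sum.cong)
      also have "(\<Sum>(x, k) \<in> P. if x \<in> E then G (Sup k) - G (Inf k) else 0) = S P"
        unfolding S_def using fin by (intro sum.mono_neutral_cong_right) (auto split: if_splits)
      also have "(\<Sum>(x, k) \<in> P. if x \<notin> E then (G (Sup k) - G (Inf k)) - measure lborel k *\<^sub>R h x else 0)
          = (\<Sum>(x, k) \<in> {(x, k) \<in> P. x \<notin> E}. (G (Sup k) - G (Inf k)) - measure lborel k *\<^sub>R h x)"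
        using fin by (intro sum.mono_neutral_cong_right) (auto split: if_splits)
      also have "(\<Sum>(x, k) \<in> P. G (Sup k) - G (Inf k)) = G b - G a"
        by (rule additive_tagged_division_1[OF \<open>a \<le> b\<close> P])
      finally have "S P + R P
          = - (\<Sum>(x, k) \<in> {(x, k) \<in> P. x \<notin> E}. (G (Sup k) - G (Inf k)) - measure lborel k *\<^sub>R h x)"
        unfolding R_def by linarith
      then show ?thesis
        using small[OF that] by (simp only: abs_minus_cancel)
    qed
    with \<open>gauge \<gamma>\<close> show ?thesis
      by blast
  qed
  have transfer: "\<forall>\<epsilon>>0. \<exists>\<gamma>. gauge \<gamma> \<and> (\<forall>P. P tagged_division_of {a..b} \<and> \<gamma> fine P \<longrightarrow> \<bar>Y P\<bar> < \<epsilon>)"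
    if X: "\<forall>\<epsilon>>0. \<exists>\<gamma>. gauge \<gamma> \<and> (\<forall>P. P tagged_division_of {a..b} \<and> \<gamma> fine P \<longrightarrow> \<bar>X P\<bar> < \<epsilon>)"
      and XY: "\<And>P. X P + Y P = S P + R P" for X Y :: "(real \<times> real set) set \<Rightarrow> real"
  proof (intro allI impI)
    fix \<epsilon> :: real assume "\<epsilon> > 0"
    then obtain \<gamma>1 \<gamma>2 where \<gamma>1: "gauge \<gamma>1"
        "\<And>P. P tagged_division_of {a..b} \<Longrightarrow> \<gamma>1 fine P \<Longrightarrow> \<bar>S P + R P\<bar> < \<epsilon> / 2"
      and \<gamma>2: "gauge \<gamma>2" "\<And>P. P tagged_division_of {a..b} \<Longrightarrow> \<gamma>2 fine P \<Longrightarrow> \<bar>X P\<bar> < \<epsilon> / 2"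
      using near[of "\<epsilon> / 2"] X by (metis half_gt_zero)
    have "\<bar>Y P\<bar> < \<epsilon>" if P: "P tagged_division_of {a..b}" and "(\<lambda>x. \<gamma>1 x \<inter> \<gamma>2 x) fine P" for P
    proof -
      have "\<gamma>1 fine P" "\<gamma>2 fine P"
        using that by (auto simp: fine_Int)
      then show ?thesis
        using \<gamma>1(2)[OF P] \<gamma>2(2)[OF P] XY[of P] by linarith
    qed
    then show "\<exists>\<gamma>. gauge \<gamma> \<and> (\<forall>P. P tagged_division_of {a..b} \<and> \<gamma> fine P \<longrightarrow> \<bar>Y P\<bar> < \<epsilon>)"
      using gauge_Int[OF \<gamma>1(1) \<gamma>2(1)] by (intro exI[of _ "\<lambda>x. \<gamma>1 x \<inter> \<gamma>2 x"]) simp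
  qed
  have "(h has_integral (G b - G a)) {a..b} \<longleftrightarrow> (h0 has_integral (G b - G a)) {a..b}"
    by (rule has_integral_spike_eq[OF null]) (auto simp: h0_def)
  also have "\<dots> \<longleftrightarrow> (\<forall>\<epsilon>>0. \<exists>\<gamma>. gauge \<gamma> \<and> (\<forall>P. P tagged_division_of {a..b} \<and> \<gamma> fine P \<longrightarrow> \<bar>R P\<bar> < \<epsilon>))"
    by (simp add: has_integral_real R_def)
  also have "\<dots> \<longleftrightarrow> (\<forall>\<epsilon>>0. \<exists>\<gamma>. gauge \<gamma> \<and> (\<forall>P. P tagged_division_of {a..b} \<and> \<gamma> fine P \<longrightarrow> \<bar>S P\<bar> < \<epsilon>))"
    using transfer[of R S] transfer[of S R] by (auto simp: add.commute)
  also have "\<dots> \<longleftrightarrow> negligible_conditional_variation a b G E"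
    unfolding negligible_conditional_variation_iff_gauge S_def ..
  finally show ?thesis .
qed

section \<open>Null images under a nonzero derivative\<close>

text \<open>Near a point with nonzero derivative \<open>g\<close> expands distances by at least a fixed factor. Let \<open>A n\<close>
  collect the points of \<open>E\<close> at which this factor is at least \<open>1 / Suc n\<close> at the scale
  \<open>1 / Suc n\<close>. On a piece of \<open>A n\<close> of smaller diameter, \<open>g\<close> is injective with Lipschitz inverse, so the
  piece is the Lipschitz image of a null set. The sets \<open>A n\<close> exhaust \<open>E\<close>.\<close>

lemma negligible_if_negligible_image_nonzero_deriv:
  fixes g :: "real \<Rightarrow> real"
  assumes "E \<subseteq> S"
    and deriv: "\<And>x. x \<in> E \<Longrightarrow> \<exists>D. D \<noteq> 0 \<and> (g has_real_derivative D) (at x within S)"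
    and null: "negligible (g ` E)"
  shows "negligible E"
proof -
  define A where "A n = {x \<in> E. \<forall>y\<in>E. \<bar>y - x\<bar> < inverse (Suc n) \<longrightarrow> \<bar>y - x\<bar> \<le> Suc n * \<bar>g y - g x\<bar>}"
    for n :: nat
  have "negligible (A n)" for n
    unfolding locally_negligible_alt[of "A n"]
  proof (intro ballI exI conjI)
    fix x assume "x \<in> A n"
    define U where "U = A n \<inter> ball x (inverse (Suc n) / 2)"
    show "openin (top_of_set (A n)) U"
      unfolding U_def by (rule openin_open_Int) simp
    show "x \<in> U"
      using \<open>x \<in> A n\<close> by (simp add: U_def)
    \<comment> \<open>The ball has half the radius at which membership in \<open>A n\<close> takes effect, so any two points
      of \<open>U\<close> are close enough.\<close>
    have exp: "\<bar>y - z\<bar> \<le> Suc n * \<bar>g y - g z\<bar>" if "y \<in> U" "z \<in> U" for y z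
    proof -
      have "dist y z < inverse (Suc n)"
        using that by (metis (no_types, lifting) IntE U_def dist_triangle_half_r mem_ball)
      then show ?thesis
        using that by (auto simp: U_def A_def dist_real_def)
    qed
    have inj: "inj_on g U"
      by (rule inj_onI) (use exp in force)
    have "negligible (g ` U)"
      by (rule negligible_subset[OF null]) (auto simp: U_def A_def)
    then have "negligible (the_inv_into U g ` (g ` U))"
    proof (rule negligible_locally_Lipschitz_image[rotated])
      fix y assume "y \<in> g ` U"
      then show "\<exists>T B. open T \<and> y \<in> T \<and> (\<forall>z\<in>g ` U \<inter> T.
          norm (the_inv_into U g z - the_inv_into U g y) \<le> B * norm (z - y))"
        using exp by (intro exI[of _ UNIV] exI[of _ "real (Suc n)"]) (auto simp: the_inv_into_f_f[OF inj])
    qed simp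
    moreover have "the_inv_into U g ` (g ` U) = U"
      using inj by (force simp: the_inv_into_f_f image_iff)
    ultimately show "negligible U"
      by simp
  qed
  moreover have "E \<subseteq> (\<Union>n. A n)"
  proof
    fix x assume "x \<in> E"
    then obtain D where D: "D \<noteq> 0" "(g has_real_derivative D) (at x within S)"
      using deriv by blast
    then have "\<bar>D\<bar> / 2 > 0"
      by simp
    with D(2) obtain d where "d > 0" and
      d: "\<And>y. y \<in> S \<Longrightarrow> \<bar>y - x\<bar> < d \<Longrightarrow> \<bar>g y - g x - D * (y - x)\<bar> \<le> \<bar>D\<bar> / 2 * \<bar>y - x\<bar>"
      unfolding has_field_derivative_def has_derivative_within_alt real_norm_def by blast
    have low: "\<bar>D\<bar> / 2 * \<bar>y - x\<bar> \<le> \<bar>g y - g x\<bar>" if "y \<in> S" "\<bar>y - x\<bar> < d" for y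
      using d[OF that] abs_mult[of D "y - x"] by linarith
    \<comment> \<open>One index serves both as scale and as expansion factor.\<close>
    obtain n where n: "inverse (Suc n) < min d (\<bar>D\<bar> / 2)"
      using reals_Archimedean[of "min d (\<bar>D\<bar> / 2)"] \<open>d > 0\<close> \<open>\<bar>D\<bar> / 2 > 0\<close> by auto
    have "\<bar>y - x\<bar> \<le> Suc n * \<bar>g y - g x\<bar>" if "y \<in> E" "\<bar>y - x\<bar> < inverse (Suc n)" for y
    proof -
      have "inverse (Suc n) * \<bar>y - x\<bar> \<le> \<bar>D\<bar> / 2 * \<bar>y - x\<bar>"
        using n by (intro mult_right_mono) auto
      also have "\<dots> \<le> \<bar>g y - g x\<bar>"
        using that n \<open>E \<subseteq> S\<close> by (intro low) auto
      finally show ?thesis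
        by (simp add: field_simps)
    qed
    then show "x \<in> (\<Union>n. A n)"
      using \<open>x \<in> E\<close> by (auto simp: A_def)
  qed
  ultimately show ?thesis
    by (meson negligible_Union_nat negligible_subset)
qed

section \<open>Differentiating the indefinite integral\<close>

text \<open>The library proposition \<open>integrable_ccontinuous_explicit\<close>, on means over small boxes with
  a given lower corner, gives the right derivative almost everywhere. Applied to the reflected
  function \<open>\<lambda>x. f (- x)\<close>, it gives the left derivative.\<close>

lemma negligible_indefinite_integral_not_deriv:
  fixes f \<Phi> :: "real \<Rightarrow> real"
  assumes f: "f integrable_on {u..v}"
    and \<Phi>: "\<And>x y. \<lbrakk>u \<le> x; x \<le> y; y \<le> v\<rbrakk> \<Longrightarrow> \<Phi> y - \<Phi> x = integral {x..y} f"
  shows "negligible {x \<in> {u<..<v}. \<not> (\<Phi> has_real_derivative f x) (at x)}"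
proof -
  define f0 where "f0 x = (if x \<in> {u..v} then f x else 0)" for x
  have int: "f0 integrable_on cbox p q" for p q
    unfolding f0_def by (rule integrable_altD(1)[OF f])
  then have int': "(\<lambda>x. f0 (- x)) integrable_on cbox p q" for p q
    using integrable_reflect[where f = f0 and a = "- q" and b = "- p"] int[of "- q" "- p"] by simp
  obtain N where N: "negligible N"
    "\<And>x e. \<lbrakk>x \<notin> N; 0 < e\<rbrakk> \<Longrightarrow> \<exists>d>0. \<forall>t. 0 < t \<and> t < d \<longrightarrow>
       \<bar>integral {x..x + t} f0 / t - f0 x\<bar> < e"
    using integrable_ccontinuous_explicit[OF int] by (auto simp: divide_inverse_commute)
  obtain M where M: "negligible M"
    "\<And>x e. \<lbrakk>x \<notin> M; 0 < e\<rbrakk> \<Longrightarrow> \<exists>d>0. \<forall>t. 0 < t \<and> t < d \<longrightarrow>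
       \<bar>integral {x..x + t} (\<lambda>x. f0 (- x)) / t - f0 (- x)\<bar> < e"
    using integrable_ccontinuous_explicit[OF int'] by (auto simp: divide_inverse_commute)
  have negM: "negligible (uminus ` M)"
    by (rule negligible_differentiable_image_negligible[OF _ M(1)]) (auto intro: derivative_intros)
  have "(\<Phi> has_real_derivative f x) (at x)" if x: "x \<in> {u<..<v}" "x \<notin> N" "x \<notin> uminus ` M" for x
    unfolding has_field_derivative_iff LIM_eq
  proof (intro allI impI)
    fix e :: real assume "e > 0"
    obtain d1 where "d1 > 0" and
      d1: "\<And>t. 0 < t \<Longrightarrow> t < d1 \<Longrightarrow> \<bar>integral {x..x + t} f0 / t - f0 x\<bar> < e"
      using N(2)[OF x(2) \<open>e > 0\<close>] by blast
    have "- x \<notin> M"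
      using x(3) by force
    obtain d2 where "d2 > 0" and
      d2: "\<And>t. 0 < t \<Longrightarrow> t < d2 \<Longrightarrow> \<bar>integral {-x..-x + t} (\<lambda>x. f0 (- x)) / t - f0 x\<bar> < e"
      using M(2)[OF \<open>- x \<notin> M\<close> \<open>e > 0\<close>] by auto
    \<comment> \<open>The last two entries keep \<open>y\<close> inside \<open>{u..v}\<close>, where \<open>f0\<close> is \<open>f\<close>.\<close>
    define d where "d = Min {d1, d2, x - u, v - x}"
    have d: "d > 0" "d \<le> d1" "d \<le> d2" "d \<le> x - u" "d \<le> v - x"
      using \<open>d1 > 0\<close> \<open>d2 > 0\<close> x(1) by (auto simp: d_def)
    have f0: "integral {p..q} f0 = integral {p..q} f" if "u \<le> p" "q \<le> v" for p q
      by (rule integral_cong) (use that in \<open>auto simp: f0_def\<close>)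
    have "\<bar>(\<Phi> y - \<Phi> x) / (y - x) - f x\<bar> < e" if y: "y \<noteq> x" "\<bar>y - x\<bar> < d" for y
    proof (cases "x < y")
      case True
      have "\<bar>integral {x..x + (y - x)} f0 / (y - x) - f0 x\<bar> < e"
        using True y d by (intro d1) auto
      moreover have "f0 x = f x" "integral {x..x + (y - x)} f0 = \<Phi> y - \<Phi> x"
        using True y d x(1) by (auto simp: f0_def f0 \<Phi>)
      ultimately show ?thesis
        by simp
    next
      case False
      have "\<bar>integral {-x..-x + (x - y)} (\<lambda>x. f0 (- x)) / (x - y) - f0 x\<bar> < e"
        using False y d by (intro d2) auto
      moreover have "integral {-x..-x + (x - y)} (\<lambda>x. f0 (- x)) = integral {y..x} f0"
        using Henstock_Kurzweil_Integration.integral_reflect_real[of x y f0] by simp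
      moreover have "f0 x = f x" "integral {y..x} f0 = \<Phi> x - \<Phi> y"
        using False y d x(1) by (auto simp: f0 \<Phi>) (simp add: f0_def)
      moreover have "(\<Phi> x - \<Phi> y) / (x - y) = (\<Phi> y - \<Phi> x) / (y - x)"
        using y(1) by (simp add: field_simps)
      ultimately show ?thesis
        by simp
    qed
    then show "\<exists>s>0. \<forall>y. y \<noteq> x \<and> norm (y - x) < s \<longrightarrow> norm ((\<Phi> y - \<Phi> x) / (y - x) - f x) < e"
      using d(1) by auto
  qed
  then show ?thesis
    by (intro negligible_subset[OF negligible_Un[OF N(1) negM]]) blast
qed

lemma hk_integral_diff:
  assumes f: "f integrable_on {u..v}" and "c \<in> {u..v}" and "u \<le> x" "x \<le> y" "y \<le> v"
  shows "hk_integral c y f - hk_integral c x f = integral {x..y} f"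
proof -
  have comb: "integral {p..q} f + integral {q..r} f = integral {p..r} f"
    if "u \<le> p" "p \<le> q" "q \<le> r" "r \<le> v" for p q r
    using that by (intro Henstock_Kurzweil_Integration.integral_combine integrable_on_subinterval[OF f]) auto
  consider "c \<le> x" | "x < c" "c \<le> y" | "y < c"
    by linarith
  then show ?thesis
    by cases (use assms comb[of c x y] comb[of x c y] comb[of x y c] in \<open>auto simp: hk_integral_def\<close>)
qed

lemma convex_hull_real_between:
  fixes x :: real
  assumes "x \<in> convex hull S"
  shows "\<exists>u\<in>S. u \<le> x" "\<exists>v\<in>S. x \<le> v"
proof -
  show "\<exists>u\<in>S. u \<le> x"
  proof (rule ccontr)
    assume "\<not> ?thesis"
    then have "convex hull S \<subseteq> {x<..}"
      by (intro hull_minimal) (auto simp: not_le)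
    with assms show False by auto
  qed
  show "\<exists>v\<in>S. x \<le> v"
  proof (rule ccontr)
    assume "\<not> ?thesis"
    then have "convex hull S \<subseteq> {..<x}"
      by (intro hull_minimal) (auto simp: not_le)
    with assms show False by auto
  qed
qed

text \<open>The set \<open>R\<close> (a range, in the application) need not be closed or bounded, so \<open>f\<close> may fail to be
  integrable on the whole hull. But being null is a local property, and each interior point of the
  hull lies strictly between two points of \<open>R\<close>, which may be chosen with \<open>c\<close> between them. The
  frontier of a convex set is null.\<close>

lemma negligible_hk_integral_not_deriv:
  fixes f F :: "real \<Rightarrow> real"
  assumes int: "\<And>u v. u \<in> R \<Longrightarrow> v \<in> R \<Longrightarrow> f integrable_on closed_segment u v"
    and c: "c \<in> R"
    and F: "\<And>x. x \<in> convex hull R \<Longrightarrow> F x = hk_integral c x f"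
  shows "negligible {x \<in> convex hull R. \<not> (F has_real_derivative f x) (at x)}"
proof -
  define N where "N = {x \<in> interior (convex hull R). \<not> (F has_real_derivative f x) (at x)}"
  have "negligible N"
    unfolding locally_negligible_alt[of N]
  proof
    fix x assume "x \<in> N"
    then obtain e where "e > 0" and e: "cball x e \<subseteq> convex hull R"
      unfolding N_def by (auto simp: mem_interior_cball)
    have "x - e \<in> convex hull R" "x + e \<in> convex hull R"
      using e \<open>e > 0\<close> by (auto simp: subset_iff dist_real_def)
    then obtain u0 v0 where uv0: "u0 \<in> R" "u0 \<le> x - e" "v0 \<in> R" "x + e \<le> v0"
      using convex_hull_real_between by meson
    \<comment> \<open>Include \<open>c\<close>, so that both values of \<open>F\<close> below are integrals within \<open>{u..v}\<close>.\<close>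
    define u v where "u = min u0 c" and "v = max v0 c"
    have uv: "u \<in> R" "v \<in> R" "u \<le> x - e" "x + e \<le> v" "c \<in> {u..v}"
      using uv0 c by (auto simp: u_def v_def min_def max_def)
    then have "u < x" "x < v"
      using \<open>e > 0\<close> by auto
    then have I: "f integrable_on {u..v}"
      using int[OF uv(1,2)] by (simp add: closed_segment_eq_real_ivl)
    have sub: "{u..v} \<subseteq> convex hull R"
      using closed_segment_subset_convex_hull[of u R v] uv \<open>u < x\<close> \<open>x < v\<close> hull_inc[of _ R convex]
      by (simp add: closed_segment_eq_real_ivl)
    have "negligible {x \<in> {u<..<v}. \<not> (F has_real_derivative f x) (at x)}"
    proof (rule negligible_indefinite_integral_not_deriv[OF I])
      fix x y assume xy: "u \<le> x" "x \<le> y" "y \<le> v"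
      then have "F x = hk_integral c x f" "F y = hk_integral c y f"
        using sub by (auto intro!: F)
      then show "F y - F x = integral {x..y} f"
        using hk_integral_diff[OF I uv(5) xy] by simp
    qed
    then have "negligible (N \<inter> {u<..<v})"
      by (rule negligible_subset) (auto simp: N_def)
    moreover have "openin (top_of_set N) (N \<inter> {u<..<v})"
      by (rule openin_open_Int) simp
    ultimately show "\<exists>U. openin (top_of_set N) U \<and> x \<in> U \<and> negligible U"
      using \<open>x \<in> N\<close> \<open>u < x\<close> \<open>x < v\<close> by (intro exI[of _ "N \<inter> {u<..<v}"]) auto
  qed
  moreover have "negligible (frontier (convex hull R))"
    by (rule negligible_convex_frontier) simp
  ultimately have "negligible (N \<union> frontier (convex hull R))"
    by simp
  then show ?thesis
    by (rule negligible_subset) (use closure_subset in \<open>auto simp: N_def frontier_def\<close>)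
qed

section \<open>Change of variables\<close>

theorem theorem5:
  fixes a b :: real and f g F :: "real \<Rightarrow> real" and B :: "real set"
  assumes "a < b"
    and "negligible {x \<in> {a..b}. \<not> g differentiable (at x within {a..b})}"
    and "\<And>u v. u \<in> g ` {a..b} \<Longrightarrow> v \<in> g ` {a..b} \<Longrightarrow> f integrable_on closed_segment u v"
    and "\<And>x. x \<in> convex hull (g ` {a..b}) \<Longrightarrow> F x = hk_integral (g a) x f"
    and "B = chain_rule_failure_set a b F f g"
  shows "(chain_integrand a b f g integrable_on {a..b} \<and>
            hk_integral (g a) (g b) f = hk_integral a b (chain_integrand a b f g))
         \<longleftrightarrow> negligible_conditional_variation a b (F \<circ> g) B"
proof -
  define h where "h = chain_integrand a b f g"
  define N where "N = {y \<in> convex hull (g ` {a..b}). \<not> (F has_real_derivative f y) (at y)}"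
  have ga: "g a \<in> g ` {a..b}" and gb: "g b \<in> g ` {a..b}"
    using \<open>a < b\<close> by auto
  have N: "negligible N"
    unfolding N_def using negligible_hk_integral_not_deriv[OF assms(3) ga assms(4)] .
  have h: "h x = f (g x) * D" if "(g has_real_derivative D) (at x within {a..b})" "x \<in> {a..b}" for x D
  proof -
    have "vector_derivative g (at x within {a..b}) = D"
      using that \<open>a < b\<close>
      by (intro vector_derivative_within_closed_interval) (auto simp: has_real_derivative_iff_has_vector_derivative)
    then show ?thesis
      using that by (auto simp: h_def chain_integrand_def real_differentiable_def)
  qed
  have off_B: "((F \<circ> g) has_real_derivative h x) (at x within {a..b})" if "x \<in> {a..b} - B" for x
    using that h unfolding assms(5) chain_rule_failure_set_def by fastforce
  define E where "E = {x \<in> B. h x \<noteq> 0}"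
  have "negligible E"
  proof (rule negligible_if_negligible_image_nonzero_deriv)
    show "E \<subseteq> {a..b}"
      by (auto simp: E_def assms(5) chain_rule_failure_set_def)
    have pt: "g x \<in> N \<and> (\<exists>D. D \<noteq> 0 \<and> (g has_real_derivative D) (at x within {a..b}))" if "x \<in> E" for x
    proof -
      have x: "x \<in> B" "x \<in> {a..b}" "h x \<noteq> 0"
        using that \<open>E \<subseteq> {a..b}\<close> by (auto simp: E_def)
      then obtain D where D: "(g has_real_derivative D) (at x within {a..b})"
        by (auto simp: h_def chain_integrand_def real_differentiable_def split: if_splits)
      with h x have "D \<noteq> 0"
        by auto
      have "\<not> (F has_real_derivative f (g x)) (at (g x))"
        using DERIV_chain[OF _ D] D x unfolding assms(5) chain_rule_failure_set_def by blast
      then have "g x \<in> N"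
        using x by (auto simp: N_def intro: hull_inc)
      with D \<open>D \<noteq> 0\<close> show ?thesis
        by blast
    qed
    then show "\<exists>D. D \<noteq> 0 \<and> (g has_real_derivative D) (at x within {a..b})" if "x \<in> E" for x
      using that by blast
    show "negligible (g ` E)"
      using N pt by (auto intro: negligible_subset)
  qed
  have "F (g a) = 0" "F (g b) = hk_integral (g a) (g b) f"
    using assms(4)[OF hull_inc[OF ga]] assms(4)[OF hull_inc[OF gb]] by (auto simp: hk_integral_def)
  then have "(h integrable_on {a..b} \<and> hk_integral (g a) (g b) f = hk_integral a b h)
      \<longleftrightarrow> (h has_integral (F \<circ> g) b - (F \<circ> g) a) {a..b}"
    using \<open>a < b\<close> by (auto simp: hk_integral_def has_integral_integrable_integral)
  also have "\<dots> \<longleftrightarrow> negligible_conditional_variation a b (F \<circ> g) B"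
    by (rule has_integral_increment_iff_negligible_conditional_variation
          [OF less_imp_le[OF \<open>a < b\<close>] off_B \<open>negligible E\<close>[unfolded E_def]])
  finally show ?thesis
    unfolding h_def .
qed

end
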